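(* Let the stochastic game be as described in the context, let $\theta_1,\dots,\theta_N$ be real numbers, fix $V>0$, and let $\{\omega(t)\}_{t\ge 0}$ in $\Omega$ and $\{b(t)\}_{t\ge 0}$ in $\mathcal{A}_1\times\cdots\times\mathcal{A}_N$ be arbitrary sequences. Suppose that $\{\alpha(t)\}_{t\ge 0}$ is generated by the weighted-sum algorithm (described in the context) with this $V$ and with $Q_i(0)=0$ for all $i\in\{1,\dots,N\}$. Let $B=\frac12\sum_{i=1}^N (u_i^{max})^2$. Then for all positive integers $T$ and $K$: $$\sum_{i=1}^N\theta_i\overline{u}_i(KT)\ \ge\ \frac1K\sum_{k=0}^{K-1}\psi_T[k]-\frac{TB}{V},$$ where $\psi_T[k]$ is the $T$-slot lookahead value of frame $k$ for the function $\phi(\gamma)=\sum_{i=1}^N\theta_i\gamma_i$.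
   Context: Game. $N\ge 2$ is an integer (number of players). $\Omega$ and $\mathcal{A}_1,\dots,\mathcal{A}_N$ are arbitrary nonempty sets (event set and action sets). For each $i$, $\hat{u}_i:\mathcal{A}_1\times\cdots\times\mathcal{A}_N\times\Omega\to\mathbb{R}$ is a utility function with $0\le \hat{u}_i(\alpha,\omega)\le u_i^{max}$ for all $(\alpha,\omega)$, where $u_i^{max}<\infty$. It is assumed that for every $\omega\in\Omega$ and all real $\beta_1,\dots,\beta_N$, the supremum of $\sum_{i=1}^N\beta_i\hat{u}_i(\alpha,\omega)$ over $\alpha\in\mathcal{A}_1\times\cdots\times\mathcal{A}_N$ is attained. Sequences. $\omega(t)$ is the event vector and $b(t)=(b_1(t),\dots,b_N(t))$ the vector of baseline actions on round $t\in\{0,1,2,\dots\}$. For an action sequence $\alpha(t)=(\alpha_1(t),\dots,\alpha_N(t))$ define $u_i(t)=\hat{u}_i(\alpha(t),\omega(t))$, $x_i(t)=\hat{u}_i(b(t),\omega(t))$, and for $t\geq 1$, $\overline{u}_i(t)=\frac1t\sum_{\tau=0}^{t-1}u_i(\tau)$. Weighted-sum algorithm with parameter $V$ and weights $\theta_i$. It maintains $Q(t)=(Q_1(t),\dots,Q_N(t))$. On every round $t\in\{0,1,2,\dots\}$: (1) choose $\alpha(t)\in\mathcal{A}_1\times\cdots\times\mathcal{A}_N$ as a maximizer of $\sum_{i=1}^N\hat{u}_i(\alpha,\omega(t))[V\theta_i+Q_i(t)]$ over $\alpha\in\mathcal{A}_1\times\cdots\times\mathcal{A}_N$ (any maximizer);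 (2) update $Q_i(t+1)=\max[Q_i(t)+x_i(t)-u_i(t),0]$ for each $i$. $T$-slot lookahead value. For a positive integer $T$, an integer $k\ge0$ and a function $\phi$ on $\prod_{i=1}^N[0,u_i^{max}]$, $\psi_T[k]$ is the supremum of $\phi(\gamma_1,\dots,\gamma_N)$ over all choices of $\gamma_i\in[0,u_i^{max}]$ and $\alpha(\tau)\in\mathcal{A}_1\times\cdots\times\mathcal{A}_N$ for $\tau\in\{kT,\dots,(k+1)T-1\}$ such that, for all $i\in\{1,\dots,N\}$, $\gamma_i=\frac1T\sum_{\tau=kT}^{(k+1)T-1}\hat{u}_i(\alpha(\tau),\omega(\tau))$ and $\gamma_i\ge\frac1T\sum_{\tau=kT}^{(k+1)T-1}\hat{u}_i(b(\tau),\omega(\tau))$. *)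

theory Defs
  imports "HOL-Analysis.Analysis"
begin

text \<open>
  Players are the naturals \<open>1, \<dots>, N\<close>. The action sets \<open>A i\<close> are arbitrary sets over a common
  carrier type; a joint action is an element of the extensional product. The utility of player \<open>i\<close>
  is \<open>u i \<alpha> \<omega>\<close>, and it is constrained only for joint actions \<open>\<alpha>\<close> and events \<open>\<omega> \<in> \<Omega>\<close>.
\<close>

definition joint_actions :: "nat \<Rightarrow> (nat \<Rightarrow> 'a set) \<Rightarrow> (nat \<Rightarrow> 'a) set" where
  "joint_actions N A = (\<Pi>\<^sub>E i\<in>{1..N}. A i)"

locale stochastic_game =
  fixes N :: nat
    and \<Omega> :: "'w set"
    and A :: "nat \<Rightarrow> 'a set"
    and u :: "nat \<Rightarrow> (nat \<Rightarrow> 'a) \<Rightarrow> 'w \<Rightarrow> real"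
    and umax :: "nat \<Rightarrow> real"
  assumes players: "N \<ge> 2"
    and events_nonempty: "\<Omega> \<noteq> {}"
    and actions_nonempty: "i \<in> {1..N} \<Longrightarrow> A i \<noteq> {}"
    and utility_nonneg: "i \<in> {1..N} \<Longrightarrow> \<alpha> \<in> joint_actions N A \<Longrightarrow> \<omega> \<in> \<Omega> \<Longrightarrow> 0 \<le> u i \<alpha> \<omega>"
    and utility_le: "i \<in> {1..N} \<Longrightarrow> \<alpha> \<in> joint_actions N A \<Longrightarrow> \<omega> \<in> \<Omega> \<Longrightarrow> u i \<alpha> \<omega> \<le> umax i"
    and sup_attained: "\<omega> \<in> \<Omega> \<Longrightarrow>
      \<exists>\<alpha>. is_arg_max (\<lambda>\<alpha>. \<Sum>i=1..N. \<beta> i * u i \<alpha> \<omega>) (\<lambda>\<alpha>. \<alpha> \<in> joint_actions N A) \<alpha>"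

definition time_average :: "(nat \<Rightarrow> real) \<Rightarrow> nat \<Rightarrow> real" where
  "time_average f t = (\<Sum>\<tau><t. f \<tau>) / real t"

text \<open>
  A relation rather than a function, because any maximizer may be chosen in each round. The initial
  value of the queues \<open>Q\<close> is left open.
\<close>

definition weighted_sum_algorithm ::
  "nat \<Rightarrow> (nat \<Rightarrow> 'a set) \<Rightarrow> (nat \<Rightarrow> (nat \<Rightarrow> 'a) \<Rightarrow> 'w \<Rightarrow> real) \<Rightarrow> real \<Rightarrow> (nat \<Rightarrow> real) \<Rightarrow>
   (nat \<Rightarrow> 'w) \<Rightarrow> (nat \<Rightarrow> nat \<Rightarrow> 'a) \<Rightarrow> (nat \<Rightarrow> nat \<Rightarrow> 'a) \<Rightarrow> (nat \<Rightarrow> nat \<Rightarrow> real) \<Rightarrow> bool" where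
  "weighted_sum_algorithm N A u V \<theta> \<omega> b \<alpha> Q \<longleftrightarrow>
    (\<forall>t. is_arg_max (\<lambda>a. \<Sum>i=1..N. u i a (\<omega> t) * (V * \<theta> i + Q t i))
           (\<lambda>a. a \<in> joint_actions N A) (\<alpha> t) \<and>
         (\<forall>i\<in>{1..N}. Q (Suc t) i = max (Q t i + u i (b t) (\<omega> t) - u i (\<alpha> t) (\<omega> t)) 0))"

definition lookahead_feasible ::
  "nat \<Rightarrow> (nat \<Rightarrow> 'a set) \<Rightarrow> (nat \<Rightarrow> (nat \<Rightarrow> 'a) \<Rightarrow> 'w \<Rightarrow> real) \<Rightarrow> (nat \<Rightarrow> real) \<Rightarrow>
   (nat \<Rightarrow> 'w) \<Rightarrow> (nat \<Rightarrow> nat \<Rightarrow> 'a) \<Rightarrow> nat \<Rightarrow> nat \<Rightarrow> (nat \<Rightarrow> real) set" where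
  "lookahead_feasible N A u umax \<omega> b T k =
    {\<gamma> \<in> (\<Pi>\<^sub>E i\<in>{1..N}. {0..umax i}).
      \<exists>a. (\<forall>\<tau>\<in>{k * T..<(k + 1) * T}. a \<tau> \<in> joint_actions N A) \<and>
        (\<forall>i\<in>{1..N}.
          \<gamma> i = (\<Sum>\<tau>\<in>{k * T..<(k + 1) * T}. u i (a \<tau>) (\<omega> \<tau>)) / real T \<and>
          \<gamma> i \<ge> (\<Sum>\<tau>\<in>{k * T..<(k + 1) * T}. u i (b \<tau>) (\<omega> \<tau>)) / real T)}"

text \<open>
  A real supremum, hence meaningful only if \<open>\<phi>\<close> is bounded above on a nonempty feasible set. The two
  lemmas at the end establish this in a stochastic game for every linear \<open>\<phi>\<close>.
\<close>

definition lookahead_value ::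
  "nat \<Rightarrow> (nat \<Rightarrow> 'a set) \<Rightarrow> (nat \<Rightarrow> (nat \<Rightarrow> 'a) \<Rightarrow> 'w \<Rightarrow> real) \<Rightarrow> (nat \<Rightarrow> real) \<Rightarrow>
   (nat \<Rightarrow> 'w) \<Rightarrow> (nat \<Rightarrow> nat \<Rightarrow> 'a) \<Rightarrow> ((nat \<Rightarrow> real) \<Rightarrow> real) \<Rightarrow> nat \<Rightarrow> nat \<Rightarrow> real" where
  "lookahead_value N A u umax \<omega> b \<phi> T k =
    (SUP \<gamma>\<in>lookahead_feasible N A u umax \<omega> b T k. \<phi> \<gamma>)"

lemma (in stochastic_game) lookahead_feasible_nonempty:
  assumes \<omega>: "\<And>t. \<omega> t \<in> \<Omega>" and b: "\<And>t. b t \<in> joint_actions N A" and T: "T > 0"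
  shows "lookahead_feasible N A u umax \<omega> b T k \<noteq> {}"
proof -
  let ?F = "{k * T..<(k + 1) * T}"
  define \<gamma> where "\<gamma> = (\<lambda>i\<in>{1..N}. (\<Sum>\<tau>\<in>?F. u i (b \<tau>) (\<omega> \<tau>)) / real T)"
  have "0 \<le> \<gamma> i \<and> \<gamma> i \<le> umax i" if i: "i \<in> {1..N}" for i
  proof -
    have "0 \<le> (\<Sum>\<tau>\<in>?F. u i (b \<tau>) (\<omega> \<tau>))"
      by (intro sum_nonneg utility_nonneg i \<omega> b)
    moreover have "(\<Sum>\<tau>\<in>?F. u i (b \<tau>) (\<omega> \<tau>)) \<le> real (card ?F) * umax i"
      by (intro sum_bounded_above utility_le i \<omega> b)
    ultimately show ?thesis
      using i T by (simp add: \<gamma>_def field_simps)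
  qed
  then have "\<gamma> \<in> (\<Pi>\<^sub>E i\<in>{1..N}. {0..umax i})"
    by (auto simp: \<gamma>_def)
  then have "\<gamma> \<in> lookahead_feasible N A u umax \<omega> b T k"
    unfolding lookahead_feasible_def using b by (auto simp: \<gamma>_def intro!: exI[of _ b])
  then show ?thesis by blast
qed

lemma (in stochastic_game) lookahead_bdd_above:
  "bdd_above ((\<lambda>\<gamma>. \<Sum>i=1..N. \<theta> i * \<gamma> i) ` lookahead_feasible N A u umax \<omega> b T k)"
proof (rule bdd_aboveI2)
  fix \<gamma> assume "\<gamma> \<in> lookahead_feasible N A u umax \<omega> b T k"
  then have \<gamma>: "0 \<le> \<gamma> i \<and> \<gamma> i \<le> umax i" if "i \<in> {1..N}" for i
    using that by (auto simp: lookahead_feasible_def PiE_iff)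
  show "(\<Sum>i=1..N. \<theta> i * \<gamma> i) \<le> (\<Sum>i=1..N. \<bar>\<theta> i\<bar> * umax i)"
  proof (rule sum_mono)
    fix i assume "i \<in> {1..N}"
    then show "\<theta> i * \<gamma> i \<le> \<bar>\<theta> i\<bar> * umax i"
      using \<gamma>[of i] by (intro mult_mono) auto
  qed
qed

end

theory Submission
  imports Defs
begin

text \<open>
  Let \<open>L t\<close> be half the sum of the squared queues. In each round the algorithm maximizes a lower
  bound for \<open>V\<close> times the weighted utility minus the drift \<open>L (t + 1) - L t\<close>, so its choice can be
  compared with any competing action. Over a frame of length \<open>T\<close> the queues are frozen at their
  values at the start of the frame; since a queue moves by at most \<open>umax i\<close> per round, this costs at
  most \<open>2 * j * B\<close> in the \<open>j\<close>-th round, hence together with the quadratic terms exactly \<open>T\<^sup>2 * B\<close>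
  per frame. The frozen queues are nonnegative, so for a feasible competitor the term they multiply
  is nonnegative and can be dropped. Summing over the frames telescopes the drift.
\<close>

text \<open>Truncation at 0 can only shrink the absolute value. Expanding the untruncated square
  leaves the remainder \<open>(x - y)\<^sup>2\<close>, and two points of \<open>[0, m]\<close>
  differ by at most \<open>m\<close>.\<close>

lemma max_zero_sq_le:
  fixes q x y m :: real
  assumes "0 \<le> x" "x \<le> m" "0 \<le> y" "y \<le> m"
  shows "(max (q + x - y) 0)\<^sup>2 \<le> q\<^sup>2 + 2 * q * (x - y) + m\<^sup>2"
proof -
  have "(max (q + x - y) 0)\<^sup>2 \<le> (q + (x - y))\<^sup>2"
    by (auto simp: max_def algebra_simps)
  also have "\<dots> = q\<^sup>2 + 2 * q * (x - y) + (x - y)\<^sup>2"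
    by (simp add: power2_sum)
  also have "(x - y)\<^sup>2 \<le> m\<^sup>2"
    using assms by (intro power2_le_iff_abs_le[THEN iffD2]) auto
  finally show ?thesis by simp
qed

locale weighted_sum_play = stochastic_game N \<Omega> A u umax
  for N :: nat
    and \<Omega> :: "'w set"
    and A :: "nat \<Rightarrow> 'a set"
    and u :: "nat \<Rightarrow> (nat \<Rightarrow> 'a) \<Rightarrow> 'w \<Rightarrow> real"
    and umax :: "nat \<Rightarrow> real" +
  fixes \<theta> :: "nat \<Rightarrow> real"
    and V :: real
    and \<omega> :: "nat \<Rightarrow> 'w"
    and b \<alpha> :: "nat \<Rightarrow> nat \<Rightarrow> 'a"
    and Q :: "nat \<Rightarrow> nat \<Rightarrow> real"
  assumes events: "\<omega> t \<in> \<Omega>"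
    and baseline: "b t \<in> joint_actions N A"
    and algorithm: "weighted_sum_algorithm N A u V \<theta> \<omega> b \<alpha> Q"
    and Q_init: "i \<in> {1..N} \<Longrightarrow> Q 0 i = 0"
begin

text \<open>The constant \<open>B\<close> of the theorem; its factor 1/2 matches the one in
  \<open>lyapunov\<close>.\<close>

definition drift_bound :: real where
  "drift_bound = (1 / 2) * (\<Sum>i=1..N. (umax i)\<^sup>2)"

definition lyapunov :: "nat \<Rightarrow> real" where
  "lyapunov t = (1 / 2) * (\<Sum>i=1..N. (Q t i)\<^sup>2)"

lemma action_joint: "\<alpha> t \<in> joint_actions N A"
  and action_maximal: "a \<in> joint_actions N A \<Longrightarrow>
    (\<Sum>i=1..N. u i a (\<omega> t) * (V * \<theta> i + Q t i))
      \<le> (\<Sum>i=1..N. u i (\<alpha> t) (\<omega> t) * (V * \<theta> i + Q t i))"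
  using algorithm unfolding weighted_sum_algorithm_def is_arg_max_linorder by blast+

lemma Q_Suc:
  "i \<in> {1..N} \<Longrightarrow> Q (Suc t) i = max (Q t i + u i (b t) (\<omega> t) - u i (\<alpha> t) (\<omega> t)) 0"
  using algorithm unfolding weighted_sum_algorithm_def by blast

lemma utility_bounds:
  assumes "i \<in> {1..N}" "a \<in> joint_actions N A"
  shows "0 \<le> u i a (\<omega> t)" "u i a (\<omega> t) \<le> umax i"
  using assms events by (auto intro: utility_nonneg utility_le)

lemma umax_nonneg: "i \<in> {1..N} \<Longrightarrow> 0 \<le> umax i"
  using utility_bounds[of i "b 0" 0] baseline by fastforce

lemma Q_nonneg: "i \<in> {1..N} \<Longrightarrow> 0 \<le> Q t i"
  by (cases t) (simp_all add: Q_init Q_Suc)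

text \<open>The untruncated increment is a difference of two utilities in
  \<open>[0, umax i]\<close>. Where the truncation acts, the raw value is negative, so 0 lies
  between it and the nonnegative \<open>Q t i\<close>, and the step only gets shorter.\<close>

lemma Q_step:
  assumes i: "i \<in> {1..N}"
  shows "\<bar>Q (Suc t) i - Q t i\<bar> \<le> umax i"
  using utility_bounds[OF i baseline, of t t] utility_bounds[OF i action_joint, of t t]
    Q_nonneg[OF i, of t] Q_Suc[OF i, of t] by linarith

lemma Q_deviation:
  assumes i: "i \<in> {1..N}"
  shows "\<bar>Q (s + j) i - Q s i\<bar> \<le> real j * umax i"
proof (induction j)
  case (Suc j)
  then show ?case using Q_step[OF i, of "s + j"] by (simp add: algebra_simps)
qed simp

lemma lyapunov_nonneg: "0 \<le> lyapunov t"
  by (simp add: lyapunov_def sum_nonneg)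

lemma lyapunov_0: "lyapunov 0 = 0"
  by (simp add: lyapunov_def Q_init)

text \<open>Half the sum of the one-queue estimates: the factor 1/2 cancels the 2 of the cross terms
  and turns the leftover squares into \<open>drift_bound\<close>.\<close>

lemma lyapunov_drift:
  "lyapunov (Suc t) - lyapunov t
    \<le> drift_bound + (\<Sum>i=1..N. Q t i * (u i (b t) (\<omega> t) - u i (\<alpha> t) (\<omega> t)))"
proof -
  have "(\<Sum>i=1..N. (Q (Suc t) i)\<^sup>2)
      \<le> (\<Sum>i=1..N. (Q t i)\<^sup>2 + 2 * Q t i * (u i (b t) (\<omega> t) - u i (\<alpha> t) (\<omega> t)) + (umax i)\<^sup>2)"
    by (intro sum_mono) (auto simp: Q_Suc intro!: max_zero_sq_le utility_bounds baseline action_joint)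
  then show ?thesis
    by (simp add: lyapunov_def drift_bound_def sum.distrib mult.assoc flip: sum_distrib_left)
qed

text \<open>By the drift estimate, the right-hand side is at least the objective maximized by
  \<open>\<alpha> t\<close>, minus terms that do not depend on the chosen action. Replacing
  \<open>\<alpha> t\<close> by \<open>a\<close> in that objective can only lower it.\<close>

lemma slot_bound:
  assumes a: "a \<in> joint_actions N A"
  shows "V * (\<Sum>i=1..N. \<theta> i * u i a (\<omega> t))
      + (\<Sum>i=1..N. Q t i * (u i a (\<omega> t) - u i (b t) (\<omega> t))) - drift_bound
    \<le> V * (\<Sum>i=1..N. \<theta> i * u i (\<alpha> t) (\<omega> t)) - (lyapunov (Suc t) - lyapunov t)"
proof -
  have *: "(\<Sum>i=1..N. u i c (\<omega> t) * (V * \<theta> i + Q t i))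
      = V * (\<Sum>i=1..N. \<theta> i * u i c (\<omega> t)) + (\<Sum>i=1..N. Q t i * u i c (\<omega> t))" for c
    by (simp add: sum.distrib sum_distrib_left algebra_simps)
  show ?thesis
    using action_maximal[OF a, of t] lyapunov_drift[of t] unfolding *
    by (simp add: right_diff_distrib sum_subtractf)
qed

text \<open>Since round \<open>s\<close>, queue \<open>i\<close> has moved by at most
  \<open>j * umax i\<close>, and it multiplies a utility difference of size at most
  \<open>umax i\<close>. The errors \<open>j * (umax i)\<^sup>2\<close> add up to
  \<open>2 * j * drift_bound\<close> because \<open>drift_bound\<close> carries a factor
  1/2.\<close>

lemma freeze_queues:
  assumes a: "a \<in> joint_actions N A"
  shows "(\<Sum>i=1..N. Q s i * (u i a (\<omega> (s + j)) - u i (b (s + j)) (\<omega> (s + j))))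
      - 2 * real j * drift_bound
    \<le> (\<Sum>i=1..N. Q (s + j) i * (u i a (\<omega> (s + j)) - u i (b (s + j)) (\<omega> (s + j))))"
proof -
  let ?d = "\<lambda>i. u i a (\<omega> (s + j)) - u i (b (s + j)) (\<omega> (s + j))"
  have "Q s i * ?d i - real j * (umax i)\<^sup>2 \<le> Q (s + j) i * ?d i" if i: "i \<in> {1..N}" for i
  proof -
    have "\<bar>?d i\<bar> \<le> umax i"
      using utility_bounds[OF i a, of "s + j"] utility_bounds[OF i baseline, of "s + j" "s + j"]
      by linarith
    then have "\<bar>(Q (s + j) i - Q s i) * ?d i\<bar> \<le> (real j * umax i) * umax i"
      unfolding abs_mult using Q_deviation[OF i, of s j] umax_nonneg[OF i]
      by (intro mult_mono) auto
    then show ?thesis by (simp add: abs_le_iff left_diff_distrib power2_eq_square)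
  qed
  then have "(\<Sum>i=1..N. Q s i * ?d i - real j * (umax i)\<^sup>2) \<le> (\<Sum>i=1..N. Q (s + j) i * ?d i)"
    by (rule sum_mono)
  then show ?thesis
    by (simp add: sum_subtractf drift_bound_def flip: sum_distrib_left)
qed

text \<open>Induction on the number of rounds, with the weights \<open>Q s i\<close> held fixed.
  Round \<open>j\<close> costs \<open>drift_bound\<close> for its quadratic terms and
  \<open>2 * j * drift_bound\<close> for freezing; the sum of the first \<open>n\<close> odd numbers
  is the square of \<open>n\<close>.\<close>

lemma partial_frame_bound:
  assumes a: "\<And>j. j < n \<Longrightarrow> a (s + j) \<in> joint_actions N A"
  shows "V * (\<Sum>j<n. \<Sum>i=1..N. \<theta> i * u i (a (s + j)) (\<omega> (s + j)))
      + (\<Sum>i=1..N. Q s i * (\<Sum>j<n. u i (a (s + j)) (\<omega> (s + j)) - u i (b (s + j)) (\<omega> (s + j))))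
      - (real n)\<^sup>2 * drift_bound
    \<le> V * (\<Sum>j<n. \<Sum>i=1..N. \<theta> i * u i (\<alpha> (s + j)) (\<omega> (s + j))) - (lyapunov (s + n) - lyapunov s)"
  using a
proof (induction n)
  case (Suc n)
  have "(real (Suc n))\<^sup>2 * drift_bound = (real n)\<^sup>2 * drift_bound + 2 * real n * drift_bound + drift_bound"
    by (simp add: power2_eq_square algebra_simps)
  then show ?case
    using Suc.IH[OF Suc.prems] slot_bound[of "a (s + n)" "s + n"] freeze_queues[of "a (s + n)" s n]
      Suc.prems[of n]
    by (simp add: distrib_left sum.distrib)
qed simp

lemma frame_bound:
  assumes V: "0 \<le> V" and T: "0 < T" and \<gamma>: "\<gamma> \<in> lookahead_feasible N A u umax \<omega> b T k"
  shows "V * real T * (\<Sum>i=1..N. \<theta> i * \<gamma> i) - (real T)\<^sup>2 * drift_bound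
    \<le> V * (\<Sum>j<T. \<Sum>i=1..N. \<theta> i * u i (\<alpha> (k * T + j)) (\<omega> (k * T + j)))
      - (lyapunov ((k + 1) * T) - lyapunov (k * T))"
proof -
  have frame: "(\<Sum>\<tau>\<in>{k * T..<(k + 1) * T}. f \<tau>) = (\<Sum>j<T. f (k * T + j))" for f :: "nat \<Rightarrow> real"
    using sum.shift_bounds_nat_ivl[of f 0 "k * T" T]
    by (simp add: add.commute lessThan_atLeast0)
  obtain a where a: "\<And>\<tau>. \<tau> \<in> {k * T..<(k + 1) * T} \<Longrightarrow> a \<tau> \<in> joint_actions N A"
    and \<gamma>_eq: "\<And>i. i \<in> {1..N} \<Longrightarrow> \<gamma> i = (\<Sum>j<T. u i (a (k * T + j)) (\<omega> (k * T + j))) / real T"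
    and \<gamma>_ge: "\<And>i. i \<in> {1..N} \<Longrightarrow> \<gamma> i \<ge> (\<Sum>j<T. u i (b (k * T + j)) (\<omega> (k * T + j))) / real T"
    using \<gamma> unfolding lookahead_feasible_def frame by blast
  have \<gamma>_sum: "(\<Sum>j<T. u i (a (k * T + j)) (\<omega> (k * T + j))) = \<gamma> i * real T" if "i \<in> {1..N}" for i
    using \<gamma>_eq[OF that] T by simp
  \<comment> \<open>Feasibility compares the competitor with the baseline only in total over the
    frame, not round by round. The sign is therefore known only because the queue weight is constant
    on the frame and factors out of the inner sum.\<close>
  have "0 \<le> (\<Sum>i=1..N. Q (k * T) i *
      (\<Sum>j<T. u i (a (k * T + j)) (\<omega> (k * T + j)) - u i (b (k * T + j)) (\<omega> (k * T + j))))"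
  proof (intro sum_nonneg[of "{1..N}"] mult_nonneg_nonneg Q_nonneg)
    show "0 \<le> (\<Sum>j<T. u i (a (k * T + j)) (\<omega> (k * T + j)) - u i (b (k * T + j)) (\<omega> (k * T + j)))"
      if "i \<in> {1..N}" for i
      using \<gamma>_ge[OF that] T by (simp add: sum_subtractf \<gamma>_sum[OF that] pos_divide_le_eq)
  qed
  moreover have "(\<Sum>j<T. \<Sum>i=1..N. \<theta> i * u i (a (k * T + j)) (\<omega> (k * T + j)))
      = real T * (\<Sum>i=1..N. \<theta> i * \<gamma> i)"
    by (subst sum.swap)
      (simp add: \<gamma>_sum sum_distrib_right mult.assoc mult.commute[of "real T"] flip: sum_distrib_left)
  moreover have "V * (\<Sum>j<T. \<Sum>i=1..N. \<theta> i * u i (a (k * T + j)) (\<omega> (k * T + j)))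
      + (\<Sum>i=1..N. Q (k * T) i *
          (\<Sum>j<T. u i (a (k * T + j)) (\<omega> (k * T + j)) - u i (b (k * T + j)) (\<omega> (k * T + j))))
      - (real T)\<^sup>2 * drift_bound
    \<le> V * (\<Sum>j<T. \<Sum>i=1..N. \<theta> i * u i (\<alpha> (k * T + j)) (\<omega> (k * T + j)))
      - (lyapunov (k * T + T) - lyapunov (k * T))"
    by (intro partial_frame_bound a) auto
  ultimately show ?thesis by (simp add: add.commute mult.assoc)
qed

text \<open>The supremum need not be attained, so the frame bound is solved for the value of
  \<open>\<gamma>\<close>, dividing by \<open>V * real T > 0\<close>. The resulting bound is the
  same for all feasible \<open>\<gamma>\<close> and passes to the supremum of the nonempty feasible
  set.\<close>

lemma lookahead_frame_bound:
  assumes V: "0 < V" and T: "0 < T"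
  shows "V * real T * lookahead_value N A u umax \<omega> b (\<lambda>\<gamma>. \<Sum>i=1..N. \<theta> i * \<gamma> i) T k
      - (real T)\<^sup>2 * drift_bound
    \<le> V * (\<Sum>j<T. \<Sum>i=1..N. \<theta> i * u i (\<alpha> (k * T + j)) (\<omega> (k * T + j)))
      - (lyapunov ((k + 1) * T) - lyapunov (k * T))" (is "_ - ?c \<le> ?r")
proof -
  have "lookahead_value N A u umax \<omega> b (\<lambda>\<gamma>. \<Sum>i=1..N. \<theta> i * \<gamma> i) T k \<le> (?r + ?c) / (V * real T)"
    unfolding lookahead_value_def
  proof (rule cSUP_least)
    show "lookahead_feasible N A u umax \<omega> b T k \<noteq> {}"
      using events baseline T by (rule lookahead_feasible_nonempty)
    show "(\<Sum>i=1..N. \<theta> i * \<gamma> i) \<le> (?r + ?c) / (V * real T)"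
      if "\<gamma> \<in> lookahead_feasible N A u umax \<omega> b T k" for \<gamma>
      using frame_bound[OF _ T that] V T by (simp add: pos_le_divide_eq mult.commute)
  qed
  then show ?thesis using V T by (simp add: pos_le_divide_eq mult.commute)
qed

lemma cumulative_bound:
  assumes V: "0 < V" and T: "0 < T"
  shows "V * real T * (\<Sum>k<K. lookahead_value N A u umax \<omega> b (\<lambda>\<gamma>. \<Sum>i=1..N. \<theta> i * \<gamma> i) T k)
      - real K * (real T)\<^sup>2 * drift_bound
    \<le> V * (\<Sum>t<K * T. \<Sum>i=1..N. \<theta> i * u i (\<alpha> t) (\<omega> t))"
proof -
  let ?\<psi> = "lookahead_value N A u umax \<omega> b (\<lambda>\<gamma>. \<Sum>i=1..N. \<theta> i * \<gamma> i) T"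
  let ?f = "\<lambda>t. \<Sum>i=1..N. \<theta> i * u i (\<alpha> t) (\<omega> t)"
  have "V * real T * (\<Sum>k<K. ?\<psi> k) - real K * (real T)\<^sup>2 * drift_bound
      = (\<Sum>k<K. V * real T * ?\<psi> k - (real T)\<^sup>2 * drift_bound)"
    by (simp add: sum_subtractf sum_distrib_left)
  also have "\<dots> \<le> (\<Sum>k<K. V * (\<Sum>j<T. ?f (k * T + j)) - (lyapunov (Suc k * T) - lyapunov (k * T)))"
    using lookahead_frame_bound[OF V T] by (intro sum_mono) simp
  also have "\<dots> = V * (\<Sum>k<K. \<Sum>j<T. ?f (k * T + j)) - (lyapunov (K * T) - lyapunov (0 * T))"
    by (subst sum_subtractf)
      (simp only: sum_lessThan_telescope[of "\<lambda>k. lyapunov (k * T)"] flip: sum_distrib_left)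
  \<comment> \<open>The first \<open>K\<close> frames partition the rounds before
    \<open>K * T\<close> into blocks of length \<open>T\<close>.\<close>
  also have "(\<Sum>k<K. \<Sum>j<T. ?f (k * T + j)) = (\<Sum>t<K * T. ?f t)"
    using sum.nat_group[of ?f T K]
    by (simp add: sum.shift_bounds_nat_ivl[of _ 0, simplified] lessThan_atLeast0 add.commute)
  finally show ?thesis
    using lyapunov_nonneg[of "K * T"] by (simp add: lyapunov_0)
qed

end

theorem theorem2:
  fixes N :: nat
    and \<Omega> :: "'w set"
    and A :: "nat \<Rightarrow> 'a set"
    and u :: "nat \<Rightarrow> (nat \<Rightarrow> 'a) \<Rightarrow> 'w \<Rightarrow> real"
    and umax \<theta> :: "nat \<Rightarrow> real"
    and V B :: real
    and \<omega> :: "nat \<Rightarrow> 'w"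
    and b \<alpha> :: "nat \<Rightarrow> nat \<Rightarrow> 'a"
    and Q :: "nat \<Rightarrow> nat \<Rightarrow> real"
    and T K :: nat
  assumes "stochastic_game N \<Omega> A u umax"
    and "V > 0"
    and "\<And>t. \<omega> t \<in> \<Omega>"
    and "\<And>t. b t \<in> joint_actions N A"
    and "weighted_sum_algorithm N A u V \<theta> \<omega> b \<alpha> Q"
    and "\<And>i. i \<in> {1..N} \<Longrightarrow> Q 0 i = 0"
    and "B = (1 / 2) * (\<Sum>i=1..N. (umax i)\<^sup>2)"
    and "T > 0" and "K > 0"
  shows "(\<Sum>i=1..N. \<theta> i * time_average (\<lambda>t. u i (\<alpha> t) (\<omega> t)) (K * T))
    \<ge> (1 / real K) * (\<Sum>k<K. lookahead_value N A u umax \<omega> b (\<lambda>\<gamma>. \<Sum>i=1..N. \<theta> i * \<gamma> i) T k)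
       - real T * B / V"
proof -
  interpret weighted_sum_play N \<Omega> A u umax \<theta> V \<omega> b \<alpha> Q
    using assms by (simp add: weighted_sum_play_def weighted_sum_play_axioms_def)
  let ?\<psi> = "\<Sum>k<K. lookahead_value N A u umax \<omega> b (\<lambda>\<gamma>. \<Sum>i=1..N. \<theta> i * \<gamma> i) T k"
  let ?S = "\<Sum>t<K * T. \<Sum>i=1..N. \<theta> i * u i (\<alpha> t) (\<omega> t)"
  have "V * real T * ?\<psi> - real K * (real T)\<^sup>2 * B \<le> V * ?S"
    using cumulative_bound[OF \<open>V > 0\<close> \<open>T > 0\<close>, of K] unfolding assms(7) drift_bound_def .
  \<comment> \<open>Dividing by \<open>V * K * T\<close> turns totals into averages and the error
    \<open>K * T\<^sup>2 * B\<close> into \<open>T * B / V\<close>.\<close>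
  then have "(V * real T * ?\<psi> - real K * (real T)\<^sup>2 * B) / (V * real K * real T)
      \<le> V * ?S / (V * real K * real T)"
    using \<open>V > 0\<close> by (intro divide_right_mono) auto
  moreover have "(V * real T * ?\<psi> - real K * (real T)\<^sup>2 * B) / (V * real K * real T)
      = (1 / real K) * ?\<psi> - real T * B / V"
    using \<open>V > 0\<close> \<open>T > 0\<close> \<open>K > 0\<close> by (simp add: field_simps power2_eq_square)
  moreover have "V * ?S / (V * real K * real T)
      = (\<Sum>i=1..N. \<theta> i * time_average (\<lambda>t. u i (\<alpha> t) (\<omega> t)) (K * T))"
    using \<open>V > 0\<close>
    by (subst sum.swap) (simp add: time_average_def sum_distrib_left sum_divide_distrib)
  ultimately show ?thesis by simp
qed

end
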